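(* Let $T$ be a quaternion tensor of size $2\times3\times3$ (three frontal slices, each a $2\times3$ quaternion matrix) or of size $3\times3\times2$ (three frontal slices, each a $3\times2$ quaternion matrix). Then $\mathrm{rank}(T)\le4$.
   Context: $\mathbb{H}$ denotes the real quaternions. An $n_1\times n_2\times n_3$ quaternion tensor is an array $T=(T_{ijk})$ with entries in $\mathbb{H}$, $1\le i\le n_1$, $1\le j\le n_2$, $1\le k\le n_3$; it is written $T=(A_1;\dots;A_{n_2})$ where the frontal slice $A_j$ is the $n_1\times n_3$ matrix $(T_{ijk})_{i,k}$. A nonzero tensor is simple if $T_{ijk}=a_ib_jc_k$ (quaternion product in this order) for some $\vec a\in\mathbb{H}^{n_1},\vec b\in\mathbb{H}^{n_2},\vec c\in\mathbb{H}^{n_3}$. The rank of $T$ is the least number of simple tensors summing to $T$ (the zero tensor has rank $0$). *)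

theory Defs
  imports Complex_Main
begin

datatype quat = Quat (Re: real) (Im1: real) (Im2: real) (Im3: real)

instantiation quat :: ring_1
begin

definition zero_quat :: quat where "0 = Quat 0 0 0 0"
definition one_quat :: quat where "1 = Quat 1 0 0 0"
definition plus_quat :: "quat \<Rightarrow> quat \<Rightarrow> quat" where
  "x + y = Quat (Re x + Re y) (Im1 x + Im1 y) (Im2 x + Im2 y) (Im3 x + Im3 y)"
definition uminus_quat :: "quat \<Rightarrow> quat" where
  "- x = Quat (- Re x) (- Im1 x) (- Im2 x) (- Im3 x)"
definition minus_quat :: "quat \<Rightarrow> quat \<Rightarrow> quat" where
  "x - y = Quat (Re x - Re y) (Im1 x - Im1 y) (Im2 x - Im2 y) (Im3 x - Im3 y)"
definition times_quat :: "quat \<Rightarrow> quat \<Rightarrow> quat" where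
  "x * y = Quat
     (Re x * Re y - Im1 x * Im1 y - Im2 x * Im2 y - Im3 x * Im3 y)
     (Re x * Im1 y + Im1 x * Re y + Im2 x * Im3 y - Im3 x * Im2 y)
     (Re x * Im2 y - Im1 x * Im3 y + Im2 x * Re y + Im3 x * Im1 y)
     (Re x * Im3 y + Im1 x * Im2 y - Im2 x * Im1 y + Im3 x * Re y)"

instance
  by standard
     (simp_all add: zero_quat_def one_quat_def plus_quat_def uminus_quat_def
        minus_quat_def times_quat_def quat.expand algebra_simps)

end

text \<open>An n1 x n2 x n3 quaternion tensor is represented as a function
  T :: nat => nat => nat => quat, indexed from 0, whose entries T i j k are
  meaningful for i < n1, j < n2, k < n3 (entries outside are ignored).
  Frontal slice j is the n1 x n3 matrix (T i j k)_{i,k}.\<close>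

type_synonym qtensor = "nat \<Rightarrow> nat \<Rightarrow> nat \<Rightarrow> quat"

definition tensor_eq :: "nat \<Rightarrow> nat \<Rightarrow> nat \<Rightarrow> qtensor \<Rightarrow> qtensor \<Rightarrow> bool" where
  "tensor_eq n1 n2 n3 S T \<longleftrightarrow>
     (\<forall>i<n1. \<forall>j<n2. \<forall>k<n3. S i j k = T i j k)"

text \<open>T (of size n1 x n2 x n3) is a sum of r simple tensors a_l (x) b_l (x) c_l,
  with entries (a_l)_i (b_l)_j (c_l)_k (quaternion product in this order).
  Nonzeroness of the summands is irrelevant for the minimum: zero summands can
  always be dropped, and for r = 0 the empty sum is the zero tensor.\<close>
definition sum_of_simple :: "nat \<Rightarrow> nat \<Rightarrow> nat \<Rightarrow> nat \<Rightarrow> qtensor \<Rightarrow> bool" where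
  "sum_of_simple n1 n2 n3 r T \<longleftrightarrow>
     (\<exists>a b c :: nat \<Rightarrow> nat \<Rightarrow> quat.
        tensor_eq n1 n2 n3 T (\<lambda>i j k. \<Sum>l<r. a l i * b l j * c l k))"

definition qtensor_rank :: "nat \<Rightarrow> nat \<Rightarrow> nat \<Rightarrow> qtensor \<Rightarrow> nat" where
  "qtensor_rank n1 n2 n3 T = (LEAST r. sum_of_simple n1 n2 n3 r T)"

end

theory Submission
  imports Defs "HOL-Combinatorics.Transposition"
begin

text \<open>
  Quaternion conjugation reverses products, hence exchanges the two formats; consider
  the format with three slices of size 2 x 3. If every slice has rank at most one, the
  slices themselves give three simple tensors. Otherwise row and column operations turn some slice
  into (I | 0). If now the third columns of the other two slices vanish, four unit
  fibres suffice. If not, a third column can be normalised to (h, 1), and for this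
  normal form four simple tensors can be written down explicitly: the first two produce the slice
  (I | 0), the third completes the second slice, and the fourth only affects the last slice.
\<close>

section \<open>Quaternions as a division ring\<close>

instantiation quat :: division_ring
begin

text \<open>The conjugate over the squared norm; at 0, real division by zero gives the value 0 that
  the class demands.\<close>

definition inverse_quat :: "quat \<Rightarrow> quat" where
  "inverse x = (let n = (Re x)\<^sup>2 + (Im1 x)\<^sup>2 + (Im2 x)\<^sup>2 + (Im3 x)\<^sup>2
     in Quat (Re x / n) (- Im1 x / n) (- Im2 x / n) (- Im3 x / n))"

definition divide_quat :: "quat \<Rightarrow> quat \<Rightarrow> quat" where
  "x div y = x * inverse (y :: quat)"

instance
proof
  fix x y :: quat
  define n where "n = (Re x)\<^sup>2 + (Im1 x)\<^sup>2 + (Im2 x)\<^sup>2 + (Im3 x)\<^sup>2"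
  have inv: "inverse x = Quat (Re x / n) (- Im1 x / n) (- Im2 x / n) (- Im3 x / n)"
    by (simp add: inverse_quat_def n_def Let_def)
  {
    assume "x \<noteq> 0"
    then have "n \<noteq> 0"
      by (auto simp: n_def zero_quat_def quat.expand add_nonneg_eq_0_iff)
    have n_eq: "Re x * Re x + Im1 x * Im1 x + Im2 x * Im2 x + Im3 x * Im3 x = n"
      by (simp add: n_def power2_eq_square)
    from \<open>n \<noteq> 0\<close> show "inverse x * x = 1" "x * inverse x = 1"
      by (simp_all add: inv times_quat_def one_quat_def mult.commute n_eq
            flip: add_divide_distrib diff_divide_distrib)
  }
  show "x div y = x * inverse y"
    by (rule divide_quat_def)
  show "inverse 0 = (0 :: quat)"
    by (simp add: inverse_quat_def zero_quat_def)
qed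

end

section \<open>Conjugation\<close>

definition quat_cnj :: "quat \<Rightarrow> quat" where
  "quat_cnj x = Quat (Re x) (- Im1 x) (- Im2 x) (- Im3 x)"

lemma quat_cnj_cnj [simp]: "quat_cnj (quat_cnj x) = x"
  by (simp add: quat_cnj_def)

lemma quat_cnj_mult: "quat_cnj (x * y) = quat_cnj y * quat_cnj x"
  by (simp add: quat_cnj_def times_quat_def algebra_simps)

lemma quat_cnj_add: "quat_cnj (x + y) = quat_cnj x + quat_cnj y"
  by (simp add: quat_cnj_def plus_quat_def)

lemma quat_cnj_sum: "quat_cnj (\<Sum>l\<in>A. f l) = (\<Sum>l\<in>A. quat_cnj (f l))"
  by (induction A rule: infinite_finite_induct)
     (simp_all add: quat_cnj_add, simp_all add: quat_cnj_def zero_quat_def)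

section \<open>Operations that preserve the number of simple summands\<close>

lemma sum_of_simpleI:
  assumes "\<And>i j k. i < n1 \<Longrightarrow> j < n2 \<Longrightarrow> k < n3 \<Longrightarrow>
    T i j k = (\<Sum>l<r. a l i * b l j * c l k)"
  shows "sum_of_simple n1 n2 n3 r T"
  using assms unfolding sum_of_simple_def tensor_eq_def by blast

text \<open>The reversed product keeps its middle factor in the middle, so only the outer two
  indices trade places.\<close>

lemma sum_of_simple_cnj:
  assumes "sum_of_simple n1 n2 n3 r (\<lambda>i j k. quat_cnj (T k j i))"
  shows "sum_of_simple n3 n2 n1 r T"
proof -
  obtain a b c where S: "\<forall>i<n1. \<forall>j<n2. \<forall>k<n3.
      quat_cnj (T k j i) = (\<Sum>l<r. a l i * b l j * c l k)"
    using assms by (auto simp: sum_of_simple_def tensor_eq_def)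
  show ?thesis
  proof (rule sum_of_simpleI)
    fix i j k assume "i < n3" "j < n2" "k < n1"
    then have "T i j k = quat_cnj (\<Sum>l<r. a l k * b l j * c l i)"
      using S by (metis quat_cnj_cnj)
    then show "T i j k = (\<Sum>l<r. quat_cnj (c l i) * quat_cnj (b l j) * quat_cnj (a l k))"
      by (simp add: quat_cnj_sum quat_cnj_mult mult.assoc)
  qed
qed

text \<open>Row operations act from the left and are absorbed into \<open>a\<close>, column
  operations act from the right and are absorbed into \<open>c\<close>, so no factors have to
  commute. In the applications \<open>S\<close> is the reduced tensor, and \<open>X\<close> and
  \<open>Y\<close> undo the reduction.\<close>

lemma sum_of_simple_transform:
  assumes "sum_of_simple n1 n2 n3 r S"
    and "\<And>i j k. i < n1 \<Longrightarrow> j < n2 \<Longrightarrow> k < n3 \<Longrightarrow>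
      T i j k = (\<Sum>m<n1. \<Sum>p<n3. X i m * S m j p * Y p k)"
  shows "sum_of_simple n1 n2 n3 r T"
proof -
  obtain a b c where S: "\<forall>i<n1. \<forall>j<n2. \<forall>k<n3.
      S i j k = (\<Sum>l<r. a l i * b l j * c l k)"
    using assms(1) by (auto simp: sum_of_simple_def tensor_eq_def)
  show ?thesis
  proof (rule sum_of_simpleI)
    fix i j k assume ijk: "i < n1" "j < n2" "k < n3"
    have "T i j k = (\<Sum>m<n1. \<Sum>p<n3. \<Sum>l<r. X i m * a l m * b l j * (c l p * Y p k))"
      using ijk S by (simp add: assms(2) sum_distrib_left sum_distrib_right mult.assoc)
    also have "\<dots> = (\<Sum>m<n1. \<Sum>l<r. \<Sum>p<n3. X i m * a l m * b l j * (c l p * Y p k))"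
      by (intro sum.cong refl sum.swap)
    also have "\<dots> = (\<Sum>l<r. \<Sum>m<n1. \<Sum>p<n3. X i m * a l m * b l j * (c l p * Y p k))"
      by (rule sum.swap)
    also have "\<dots> = (\<Sum>l<r. (\<Sum>m<n1. X i m * a l m) * b l j * (\<Sum>p<n3. c l p * Y p k))"
      by (simp only: sum_distrib_right, simp only: sum_distrib_left)
    finally show "T i j k = \<dots>" .
  qed
qed

lemma sum_of_simple_transpose:
  assumes "sum_of_simple n1 n2 n3 r
      (\<lambda>i j k. T (transpose i0 i1 i) (transpose j0 j1 j) (transpose k0 k1 k))"
    and "i0 < n1" "i1 < n1" "j0 < n2" "j1 < n2" "k0 < n3" "k1 < n3"
  shows "sum_of_simple n1 n2 n3 r T"
proof -
  obtain a b c where S: "\<forall>i<n1. \<forall>j<n2. \<forall>k<n3.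
      T (transpose i0 i1 i) (transpose j0 j1 j) (transpose k0 k1 k)
        = (\<Sum>l<r. a l i * b l j * c l k)"
    using assms(1) by (auto simp: sum_of_simple_def tensor_eq_def)
  show ?thesis
  proof (rule sum_of_simpleI)
    fix i j k assume "i < n1" "j < n2" "k < n3"
    then have "transpose i0 i1 i < n1" "transpose j0 j1 j < n2" "transpose k0 k1 k < n3"
      using assms by (auto simp: transpose_def)
    with S show "T i j k = (\<Sum>l<r. a l (transpose i0 i1 i) * b l (transpose j0 j1 j)
        * c l (transpose k0 k1 k))"
      by (metis transpose_involutory)
  qed
qed

lemma less_2_disj: "i < (2::nat) \<longleftrightarrow> i = 0 \<or> i = 1"
  by auto

lemma less_3_disj: "i < (3::nat) \<longleftrightarrow> i = 0 \<or> i = 1 \<or> i = 2"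
  by auto

lemma sum_less_2: "(\<Sum>l<2::nat. f l) = f 0 + (f 1 :: 'a :: comm_monoid_add)"
  by (simp add: numeral_2_eq_2)

lemma sum_less_3: "(\<Sum>l<3::nat. f l) = f 0 + f 1 + (f 2 :: 'a :: comm_monoid_add)"
  by (simp add: eval_nat_numeral)

lemma sum_less_4: "(\<Sum>l<4::nat. f l) = f 0 + f 1 + f 2 + (f 3 :: 'a :: comm_monoid_add)"
  by (simp add: eval_nat_numeral)

lemmas small_index = less_2_disj less_3_disj sum_less_2 sum_less_3 sum_less_4

section \<open>Explicit decompositions\<close>

lemma sum_of_simple_zero_column:
  assumes "\<forall>i<2. \<forall>j<3. T i j 2 = 0"
  shows "sum_of_simple 2 3 3 4 T"
  \<comment> \<open>The index \<open>l\<close> encodes the position (\<open>l div 2\<close>,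
    \<open>l mod 2\<close>) in the first two columns; each summand carries the fibre of
    \<open>T\<close> there.\<close>
  by (rule sum_of_simpleI[where a = "\<lambda>l i. if i = l div 2 then 1 else 0"
        and b = "\<lambda>l j. T (l div 2) j (l mod 2)" and c = "\<lambda>l k. if k = l mod 2 then 1 else 0"])
     (use assms in \<open>auto simp: small_index\<close>)

lemma sum_of_simple_rank_one_slices:
  assumes "\<forall>j<3. \<exists>a c. \<forall>i<2. \<forall>k<3. T i j k = a i * c k"
  shows "sum_of_simple 2 3 3 4 T"
proof -
  obtain a c where ac: "\<forall>j<3. \<forall>i<2. \<forall>k<3. T i j k = a j i * c j k"
    using assms by metis
  show ?thesis
  proof (rule sum_of_simpleI)
    fix i j k :: nat assume "i < 2" "j < 3" "k < 3"
    \<comment> \<open>Only the summand \<open>l = j\<close> survives; \<open>l = 3\<close> pads the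
      sum to four terms, since \<open>j < 3\<close>.\<close>
    moreover have "a l i * (if l = j then 1 else 0) * c l k = (if l = j then a l i * c l k else 0)"
      for l
      by simp
    ultimately show "T i j k = (\<Sum>l<4. a l i * (if l = j then 1 else 0) * c l k)"
      using ac by simp
  qed
qed

text \<open>With e = (h, 1), the left factors are (1, 0), e + (1, 0), e and 2e + (1, 0). Their
  coefficients are integers, hence central, so the equations for row 1 and for row 0 minus
  \<open>h\<close> times row 1 can be solved column by column.\<close>

lemma sum_of_simple_normal_form:
  assumes A0: "T 0 0 0 = 1" "T 0 0 1 = 0" "T 0 0 2 = 0" "T 1 0 0 = 0" "T 1 0 1 = 1" "T 1 0 2 = 0"
    and A1: "T 1 1 0 = 0" "T 1 1 2 = 1"
  shows "sum_of_simple 2 3 3 4 T"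
proof -
  define h where "h = T 0 1 2"
  define p where "p = T 0 1 0"
  \<comment> \<open>Column 1 of slice 1: row 0 minus \<open>h\<close> times row 1 determines
    \<open>m\<close>, and row 1 requires \<open>m + \<rho> = T 1 1 1\<close>.\<close>
  define m where "m = T 0 1 1 + p * (h + 1) - h * T 1 1 1"
  define \<rho> where "\<rho> = T 1 1 1 - m"
  \<comment> \<open>In slice 2, column 0 determines \<open>c0\<close> and \<open>b\<close>, and
    column 2 determines \<open>c2\<close> and \<open>f\<close>.\<close>
  define c0 where "c0 = inverse 2 * T 1 2 0"
  define b where "b = T 0 2 0 - (1 + 2 * h) * c0"
  define c2 where "c2 = T 0 2 2 - h * T 1 2 2"
  define f where "f = T 1 2 2 - 2 * c2"
  \<comment> \<open>In column 1 of slice 2, row 1 prescribes \<open>d + 2 * c1\<close>, and row 0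
    minus \<open>h\<close> times row 1 prescribes \<open>d + c1\<close>; the difference is
    \<open>c1\<close>.\<close>
  define c1 where "c1 = T 1 2 1 - f * \<rho> - (T 0 2 1 - h * T 1 2 1 + b * (h + 1))"
  define d where "d = T 1 2 1 - f * \<rho> - 2 * c1"
  have "(2 :: quat) \<noteq> 0"
    unfolding one_add_one [symmetric]
    by (simp only: zero_quat_def one_quat_def plus_quat_def) simp
  then have c0: "T 1 2 0 = 2 * c0"
    by (simp add: c0_def flip: mult.assoc)
  show ?thesis
    by (rule sum_of_simpleI[where a = "\<lambda>l i. [[1, 0], [1 + h, 1], [h, 1], [1 + 2 * h, 2]] ! l ! i"
          and b = "\<lambda>l j. [[1, p, b], [1, m, d], [0, 1, f], [0, 0, 1]] ! l ! j"
          and c = "\<lambda>l k. [[1, - h - 1, 0], [0, 1, 0], [0, \<rho>, 1], [c0, c1, c2]] ! l ! k"])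
       (use A0 A1 c0 in \<open>auto simp: small_index h_def [symmetric, simplified]
          p_def [symmetric, simplified] \<rho>_def m_def b_def c2_def f_def c1_def d_def
          algebra_simps mult_2 mult_2_right\<close>)
qed

section \<open>Reduction to the normal form\<close>

lemma sum_of_simple_identity_slice_nonzero:
  assumes A0: "T 0 0 0 = 1" "T 0 0 1 = 0" "T 0 0 2 = 0" "T 1 0 0 = 0" "T 1 0 1 = 1" "T 1 0 2 = 0"
    and w: "T 1 1 2 \<noteq> 0"
  shows "sum_of_simple 2 3 3 4 T"
proof -
  define w where "w = T 1 1 2"
  define v where "v = T 1 1 0"
  have [simp]: "w \<noteq> 0"
    using w by (simp add: w_def)
  \<comment> \<open>Scaling column 2 makes the entry \<open>w\<close> equal to 1, and subtracting a
    multiple of that column clears \<open>v\<close>. Slice 0 is unaffected because its column 2 is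
    zero.\<close>
  let ?S = "\<lambda>i j k. if k = 2 then T i j 2 * inverse w
    else if k = 0 then T i j 0 - T i j 2 * inverse w * v else T i j k"
  have "sum_of_simple 2 3 3 4 ?S"
    by (rule sum_of_simple_normal_form)
       (use A0 in \<open>simp_all add: w_def [symmetric, simplified] v_def [symmetric, simplified]\<close>)
  then show ?thesis
    by (rule sum_of_simple_transform[where X = "\<lambda>i m. if i = m then 1 else 0"
          and Y = "\<lambda>p k. [[1, 0, 0], [0, 1, 0], [v, 0, w]] ! p ! k"])
       (auto simp: small_index mult.assoc)
qed

lemma sum_of_simple_identity_slice:
  assumes A0: "T 0 0 0 = 1" "T 0 0 1 = 0" "T 0 0 2 = 0" "T 1 0 0 = 0" "T 1 0 1 = 1" "T 1 0 2 = 0"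
  shows "sum_of_simple 2 3 3 4 T"
proof (cases "\<forall>i<2. \<forall>j<3. T i j 2 = 0")
  case True
  then show ?thesis
    by (rule sum_of_simple_zero_column)
next
  case False
  then obtain i j where ij: "i < 2" "j < 3" "T i j 2 \<noteq> 0"
    by blast
  have "j \<noteq> 0"
  proof
    assume "j = 0"
    with ij A0 show False
      by (auto simp: less_2_disj)
  qed
  \<comment> \<open>Rows and columns are swapped by the same transposition, which preserves the
    identity block of slice 0; this slice stays in place because \<open>j\<close> is
    nonzero.\<close>
  have "sum_of_simple 2 3 3 4 (\<lambda>i' j' k'. T (transpose 1 i i') (transpose 1 j j') (transpose 1 i k'))"
    by (rule sum_of_simple_identity_slice_nonzero)
       (use A0 ij \<open>j \<noteq> 0\<close> in \<open>auto simp: transpose_def less_2_disj\<close>)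
  then show ?thesis
    by (rule sum_of_simple_transpose) (use ij in auto)
qed

lemma sum_of_simple_pivots:
  assumes s: "T 0 0 0 \<noteq> 0" and v: "T 1 0 1 \<noteq> T 1 0 0 * inverse (T 0 0 0) * T 0 0 1"
  shows "sum_of_simple 2 3 3 4 T"
proof -
  \<comment> \<open>Gaussian elimination over a skew field: slice 0 factors as a lower unitriangular
    matrix, (I | 0) and an upper triangular matrix. The pivots are \<open>s\<close> and the Schur
    complement \<open>v1\<close>.\<close>
  define s where "s = T 0 0 0"
  define g where "g = T 1 0 0 * inverse s"
  define u1 where "u1 = T 0 0 1"
  define u2 where "u2 = T 0 0 2"
  define v1 where "v1 = T 1 0 1 - g * u1"
  define v2 where "v2 = T 1 0 2 - g * u2"
  have nz [simp]: "s \<noteq> 0" "v1 \<noteq> 0"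
    using s v by (auto simp: s_def v1_def g_def u1_def)
  have T0: "T 0 0 0 = s" "T 0 0 1 = u1" "T 0 0 2 = u2"
      "T 1 0 0 = g * s" "T 1 0 1 = v1 + g * u1" "T 1 0 2 = v2 + g * u2"
    by (simp_all add: s_def u1_def u2_def v1_def v2_def g_def mult.assoc s)
  define R where "R i j k = (if i = 1 then T 1 j k - g * T 0 j k else T i j k)" for i j k :: nat
  define C where "C i j = (R i j 1 - R i j 0 * inverse s * u1) * inverse v1" for i j :: nat
  let ?S = "\<lambda>i j k. if k = 0 then R i j 0 * inverse s else if k = 1 then C i j
    else R i j 2 - R i j 0 * inverse s * u2 - C i j * v2"
  have "sum_of_simple 2 3 3 4 ?S"
    by (rule sum_of_simple_identity_slice) (simp_all add: R_def C_def T0 [simplified])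
  then show ?thesis
    by (rule sum_of_simple_transform[where X = "\<lambda>i m. [[1, 0], [g, 1]] ! i ! m"
          and Y = "\<lambda>p k. [[s, u1, u2], [0, v1, v2], [0, 0, 1]] ! p ! k"])
       (auto simp: small_index R_def C_def mult.assoc algebra_simps)
qed

lemma sum_of_simple_first_pivot:
  assumes s: "T 0 0 0 \<noteq> 0" and nr: "\<And>a c. \<exists>i<2. \<exists>k<3. T i 0 k \<noteq> a i * c k"
  shows "sum_of_simple 2 3 3 4 T"
proof -
  define g where "g = T 1 0 0 * inverse (T 0 0 0)"
  \<comment> \<open>If row 1 were \<open>g\<close> times row 0, slice 0 would be the product of the
    column (1, g) and row 0.\<close>
  obtain k where k: "k < 3" "T 1 0 k \<noteq> g * T 0 0 k"
    using nr[of "\<lambda>i. if i = 0 then 1 else g" "T 0 0"] by (auto simp: less_2_disj)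
  moreover have "k \<noteq> 0"
    using k s by (intro notI) (simp add: g_def mult.assoc)
  ultimately have "sum_of_simple 2 3 3 4
      (\<lambda>i' j' k'. T (transpose 0 0 i') (transpose 0 0 j') (transpose 1 k k'))"
    by (intro sum_of_simple_pivots) (use s in \<open>auto simp: g_def transpose_def\<close>)
  then show ?thesis
    by (rule sum_of_simple_transpose) (use k in auto)
qed

lemma sum_of_simple_2_3_3: "sum_of_simple 2 3 3 4 T"
proof (cases "\<forall>j<3. \<exists>a c. \<forall>i<2. \<forall>k<3. T i j k = a i * c k")
  case True
  then show ?thesis
    by (rule sum_of_simple_rank_one_slices)
next
  case False
  then obtain j where j: "j < 3" "\<And>a c. \<exists>i<2. \<exists>k<3. T i j k \<noteq> a i * c k"
    by blast
  \<comment> \<open>Zero factors would produce a zero slice, so slice \<open>j\<close> has a nonzero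
    entry to serve as the first pivot.\<close>
  obtain i k where ik: "i < 2" "k < 3" "T i j k \<noteq> 0"
    using j(2)[of "\<lambda>_. 0" "\<lambda>_. 0"] by auto
  let ?S = "\<lambda>i' j' k'. T (transpose 0 i i') (transpose 0 j j') (transpose 0 k k')"
  \<comment> \<open>A factorisation of the permuted slice would give one of slice \<open>j\<close>
    by permuting both factors.\<close>
  have "\<exists>i'<2. \<exists>k'<3. ?S i' 0 k' \<noteq> a i' * c k'" for a c
  proof -
    obtain i' k' where ik': "i' < 2" "k' < 3"
        "T i' j k' \<noteq> a (transpose 0 i i') * c (transpose 0 k k')"
      using j(2)[of "\<lambda>i'. a (transpose 0 i i')" "\<lambda>k'. c (transpose 0 k k')"] by blast
    moreover have "transpose 0 i i' < 2" "transpose 0 k k' < 3"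
      using ik ik' by (auto simp: transpose_def)
    ultimately show ?thesis
      by (intro exI[of _ "transpose 0 i i'"] exI[of _ "transpose 0 k k'"] conjI) auto
  qed
  then have "sum_of_simple 2 3 3 4 ?S"
    by (intro sum_of_simple_first_pivot) (use ik in auto)
  then show ?thesis
    by (rule sum_of_simple_transpose) (use ik j in auto)
qed

theorem mainTheorem11:
  fixes T :: qtensor
  shows "qtensor_rank 2 3 3 T \<le> 4 \<and> qtensor_rank 3 3 2 T \<le> 4"
  unfolding qtensor_rank_def
  by (intro conjI Least_le sum_of_simple_2_3_3 sum_of_simple_cnj[OF sum_of_simple_2_3_3])

end
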